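(* Let $n\ge3$, $m=n-2$, and $1\le k\le n-1$. Define $g_{k,m}(j)=r_m(j,j+k)$ for integers $j\in[1,n-k]$. Then $g_{k,m}$ is unimodal on $[1,n-k]$ with its maxima at the endpoints and its minimum (minima) at \[ j=\begin{cases}\frac{m-k+3}{2}, & m-k \text{ odd},\\[1mm] \frac{m-k+3+1}{2},\ \frac{m-k+3-1}{2}, & m-k\text{ even}.\end{cases} \] Moreover, $g_{k,m}$ is strictly decreasing from the left endpoint to its (first) minimum, strictly increasing from its (second) minimum to its right endpoint, and $g_{k,m}(j)=g_{k,m}(n-k-j+1)$.
   Context: $r_m(a,b)$ is the resistance distance between vertices $a,b$ of the straight linear 2-tree on $n=m+2$ vertices (vertex set $\{1,\dots,n\}$, $\{a,b\}$ an edge iff $0<|a-b|\le 2$), with every edge a unit resistor: $r_m(a,b)=(\mathbf e_a-\mathbf e_b)^TL^{\dagger}(\mathbf e_a-\mathbf e_b)$, $L^\dagger$ the Moore–Penrose inverse of the Laplacian. *)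

theory Defs
  imports "Jordan_Normal_Form.Matrix"
begin

section \<open>Moore--Penrose inverse\<close>

text \<open>The four Penrose conditions. The matrices are real, so the adjoint is the transpose.\<close>

definition is_moore_penrose :: "real mat \<Rightarrow> real mat \<Rightarrow> bool" where
  "is_moore_penrose A X \<longleftrightarrow>
     X \<in> carrier_mat (dim_col A) (dim_row A) \<and>
     A * X * A = A \<and>
     X * A * X = X \<and>
     transpose_mat (A * X) = A * X \<and>
     transpose_mat (X * A) = X * A"

definition moore_penrose :: "real mat \<Rightarrow> real mat" where
  "moore_penrose A = (THE X. is_moore_penrose A X)"

lemma is_moore_penrose_unique:
  assumes X: "is_moore_penrose A X" and Y: "is_moore_penrose A Y"
  shows "X = Y"
proof -
  define r c where "r = dim_row A" and "c = dim_col A"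
  have A: "A \<in> carrier_mat r c" by (auto simp: r_def c_def)
  have cX: "X \<in> carrier_mat c r" and cY: "Y \<in> carrier_mat c r"
    using X Y by (auto simp: is_moore_penrose_def r_def c_def)
  have AX: "A * X \<in> carrier_mat r r" and AY: "A * Y \<in> carrier_mat r r"
    and XA: "X * A \<in> carrier_mat c c" and YA: "Y * A \<in> carrier_mat c c"
    using A cX cY by (auto intro: mult_carrier_mat)
  have x: "A * X * A = A" "X * A * X = X" "transpose_mat (A * X) = A * X"
      "transpose_mat (X * A) = X * A"
    using X by (auto simp: is_moore_penrose_def)
  have y: "A * Y * A = A" "Y * A * Y = Y" "transpose_mat (A * Y) = A * Y"
      "transpose_mat (Y * A) = Y * A"
    using Y by (auto simp: is_moore_penrose_def)
  have "(A * Y) * (A * X) = A * Y * A * X"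
    using assoc_mult_mat[OF AY A cX] by simp
  then have 1: "(A * Y) * (A * X) = A * X" by (simp add: y)
  have "(A * X) * (A * Y) = A * X * A * Y"
    using assoc_mult_mat[OF AX A cY] by simp
  then have 2: "(A * X) * (A * Y) = A * Y" by (simp add: x)
  have eq1: "A * X = A * Y"
    using transpose_mult[OF AX AY] 1 2 x(3) y(3) by simp
  have "(X * A) * (Y * A) = X * (A * (Y * A))"
    using assoc_mult_mat[OF cX A YA] by simp
  also have "A * (Y * A) = A * Y * A" using assoc_mult_mat[OF A cY A] by simp
  finally have 3: "(X * A) * (Y * A) = X * A" by (simp add: y)
  have "(Y * A) * (X * A) = Y * (A * (X * A))"
    using assoc_mult_mat[OF cY A XA] by simp
  also have "A * (X * A) = A * X * A" using assoc_mult_mat[OF A cX A] by simp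
  finally have 4: "(Y * A) * (X * A) = Y * A" by (simp add: x)
  have eq2: "X * A = Y * A"
    using transpose_mult[OF XA YA] 3 4 x(4) y(4) by simp
  have "X = X * A * X" by (simp add: x)
  also have "\<dots> = Y * A * X" by (simp add: eq2)
  also have "\<dots> = Y * (A * X)" by (rule assoc_mult_mat[OF cY A cX])
  also have "\<dots> = Y * (A * Y)" by (simp add: eq1)
  also have "\<dots> = Y * A * Y" using assoc_mult_mat[OF cY A cY] by simp
  also have "\<dots> = Y" by (rule y)
  finally show ?thesis .
qed

lemma moore_penrose_eqI: "is_moore_penrose A X \<Longrightarrow> moore_penrose A = X"
  unfolding moore_penrose_def using is_moore_penrose_unique by (intro the_equality)


section \<open>Resistance distance\<close>

text \<open>
  Graphs have vertex set \<open>{1..n}\<close> and an adjacency relation \<open>E\<close>; every edge is a unit resistor.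
  Matrix and vector indices start at 0, so vertex \<open>a\<close> has index \<open>a - 1\<close>.
\<close>

definition laplacian :: "nat \<Rightarrow> (nat \<Rightarrow> nat \<Rightarrow> bool) \<Rightarrow> real mat" where
  "laplacian n E = mat n n (\<lambda>(i, j).
     if i = j then real (card {b \<in> {1..n}. E (Suc i) b})
     else if E (Suc i) (Suc j) then - 1 else 0)"

definition resistance_distance :: "nat \<Rightarrow> (nat \<Rightarrow> nat \<Rightarrow> bool) \<Rightarrow> nat \<Rightarrow> nat \<Rightarrow> real" where
  "resistance_distance n E a b =
     (let d = unit_vec n (a - 1) - unit_vec n (b - 1)
      in d \<bullet> (moore_penrose (laplacian n E) *\<^sub>v d))"

definition straight_2tree_adj :: "nat \<Rightarrow> nat \<Rightarrow> bool" where
  "straight_2tree_adj a b \<longleftrightarrow> 0 < \<bar>int a - int b\<bar> \<and> \<bar>int a - int b\<bar> \<le> 2"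

text \<open>The index \<open>m\<close> counts triangles; the straight linear 2-tree has \<open>m + 2\<close> vertices.\<close>

definition r :: "nat \<Rightarrow> nat \<Rightarrow> nat \<Rightarrow> real" where
  "r m a b = resistance_distance (m + 2) straight_2tree_adj a b"

definition g :: "nat \<Rightarrow> nat \<Rightarrow> nat \<Rightarrow> real" where
  "g k m j = r m j (j + k)"


section \<open>Unimodality and extremal points\<close>

text \<open>
  Unimodality in the valley-shaped sense (maxima at the ends, minimum inside). Monotonicity is
  weak because the minimum may be attained at two adjacent points.
\<close>

definition valley_unimodal_on :: "nat \<Rightarrow> nat \<Rightarrow> (nat \<Rightarrow> real) \<Rightarrow> bool" where
  "valley_unimodal_on a b f \<longleftrightarrow>
     (\<exists>c\<in>{a..b}. antimono_on {a..c} f \<and> mono_on {c..b} f)"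

definition minimizers :: "('a \<Rightarrow> real) \<Rightarrow> 'a set \<Rightarrow> 'a set" where
  "minimizers f A = {x. is_arg_min f (\<lambda>x. x \<in> A) x}"

definition maximizers :: "('a \<Rightarrow> real) \<Rightarrow> 'a set \<Rightarrow> 'a set" where
  "maximizers f A = {x. is_arg_max f (\<lambda>x. x \<in> A) x}"

end

theory Submission
  imports Defs "Jordan_Normal_Form.Determinant"
begin

text \<open>
  Let \<open>V\<^sub>s\<close> be the potential of a unit current between the vertices \<open>s\<close> and \<open>s + 1\<close>. By
  polarization, \<open>r(j+1, j+k+1) - r(j, j+k)\<close> is a sum of four values of \<open>V\<^sub>j - V\<^bsub>j+k\<^esub>\<close>. Away from
  the sources a potential satisfies a recurrence with characteristic roots \<open>1, 1\<close> and
  \<open>-\<phi>\<^sup>2, -\<phi>\<^bsup>-2\<^esup>\<close> (\<open>\<phi>\<close> the golden ratio), so \<open>V\<^sub>s\<close> is alternating and hyperbolic in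
  \<open>\<theta> = ln \<phi> = arsinh (1/2)\<close> on each side of its source. The four values combine to a positive
  multiple of \<open>sinh (2 (2j + k - n) \<theta>)\<close>. Hence \<open>g k m j = \<alpha> + \<beta> cosh (2 (2j - (n-k+1)) \<theta>)\<close> with
  \<open>\<beta> > 0\<close>, which depends on, and increases with, the distance of \<open>j\<close> from \<open>(n-k+1)/2\<close>.
\<close>

section \<open>Moore--Penrose inverse of a connected Laplacian\<close>

text \<open>\<open>J\<close> is the orthogonal projection onto the kernel of \<open>L\<close>; then \<open>L + J\<close> is invertible and the
  pseudoinverse is \<open>(L + J)\<^sup>-\<^sup>1 - J\<close>.\<close>

lemma moore_penrose_of_kernel_projection:
  assumes L: "L \<in> carrier_mat n n" and J: "J \<in> carrier_mat n n"
    and LT: "transpose_mat L = L" and JT: "transpose_mat J = J"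
    and JJ: "J * J = J" and LJ: "L * J = 0\<^sub>m n n"
    and ker: "\<And>v. v \<in> carrier_vec n \<Longrightarrow> L *\<^sub>v v = 0\<^sub>v n \<Longrightarrow> J *\<^sub>v v = 0\<^sub>v n \<Longrightarrow> v = 0\<^sub>v n"
  obtains G where "is_moore_penrose L G" "G \<in> carrier_mat n n" "transpose_mat G = G"
    "G * L = 1\<^sub>m n - J"
proof -
  define X where "X = L + J"
  have X: "X \<in> carrier_mat n n" using L J by (simp add: X_def)
  have JL: "J * L = 0\<^sub>m n n"
    using transpose_mult[OF L J] LJ LT JT by simp
  have JX: "J * X = J" and XJ: "X * J = J"
    using L J JL LJ JJ by (simp_all add: X_def mult_add_distrib_mat[OF J L J] add_mult_distrib_mat[OF L J J])
  \<comment> \<open>Since \<open>J * X = J\<close>, a null vector of \<open>X\<close> is killed by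
    \<open>J\<close>, hence also by \<open>L\<close>, and \<open>ker\<close> forces it to be
    zero.\<close>
  have "det X \<noteq> 0"
  proof
    assume "det X = 0"
    then obtain v where v: "v \<in> carrier_vec n" "v \<noteq> 0\<^sub>v n" "X *\<^sub>v v = 0\<^sub>v n"
      using det_0_iff_vec_prod_zero[OF X] by auto
    have "J *\<^sub>v v = J *\<^sub>v (X *\<^sub>v v)"
      using assoc_mult_mat_vec[OF J X v(1)] JX by simp
    also have "\<dots> = 0\<^sub>v n" using J by (auto simp: v(3))
    finally have Jv: "J *\<^sub>v v = 0\<^sub>v n" .
    then have "L *\<^sub>v v = 0\<^sub>v n"
      using v(3) add_mult_distrib_mat_vec[OF L J v(1)] L v(1)
      by (simp add: X_def)
    with ker v Jv show False by blast
  qed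
  then obtain Y where Y: "Y \<in> carrier_mat n n" "Y * X = 1\<^sub>m n" "X * Y = 1\<^sub>m n"
    using det_non_zero_imp_unit[OF X, of "()"] by (auto simp: Units_def ring_mat_def)
  have XT: "transpose_mat X = X"
    using transpose_add[OF L J] by (simp add: X_def LT JT)
  have YT: "transpose_mat Y = Y"
  proof -
    have T: "transpose_mat Y \<in> carrier_mat n n" using Y by simp
    have "transpose_mat Y * X = 1\<^sub>m n"
      using transpose_mult[OF X Y(1)] by (simp add: XT Y(3))
    then have "transpose_mat Y * X * Y = Y" using Y(1) by simp
    then show ?thesis using assoc_mult_mat[OF T X Y(1)] Y(3) T by simp
  qed
  have YJ: "Y * J = J"
    using assoc_mult_mat[OF Y(1) X J] XJ Y(2) J by simp
  have JY: "J * Y = J"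
    using transpose_mult[OF Y(1) J] YJ YT JT by simp
  define G where "G = Y - J"
  have G: "G \<in> carrier_mat n n" using J Y by (auto simp: G_def)
  have GT: "transpose_mat G = G"
    using J Y by (auto simp: G_def YT JT transpose_minus)
  have LX: "L = X - J" using L J by (auto simp: X_def)
  have YL: "Y * L = 1\<^sub>m n - J"
    by (subst LX) (simp add: mult_minus_distrib_mat[OF Y(1) X J] Y YJ)
  have GL: "G * L = 1\<^sub>m n - J"
    using J by (simp add: G_def minus_mult_distrib_mat[OF Y(1) J L] JL YL) auto
  have I: "1\<^sub>m n - J \<in> carrier_mat n n" using J by (rule minus_carrier_mat)
  have IT: "transpose_mat (1\<^sub>m n - J) = 1\<^sub>m n - J"
    by (subst transpose_minus[OF one_carrier_mat J]) (simp add: JT)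
  \<comment> \<open>Both products are now the same symmetric projection; the two remaining Penrose
    conditions reduce to \<open>J * L = 0\<close> and \<open>J * G = 0\<close>.\<close>
  have LG: "L * G = 1\<^sub>m n - J"
    using transpose_mult[OF G L] GL IT LT GT by simp
  have "L * G * L = L"
    using minus_mult_distrib_mat[OF one_carrier_mat J L] L by (simp add: LG JL) auto
  moreover have "J * G = 0\<^sub>m n n"
    using mult_minus_distrib_mat[OF J Y(1) J] J by (simp add: G_def JY JJ)
  then have "G * L * G = G"
    using minus_mult_distrib_mat[OF one_carrier_mat J G] G by (simp add: GL) auto
  ultimately have "is_moore_penrose L G"
    using L G by (simp add: is_moore_penrose_def LG GL IT)
  with that G GT GL show thesis by blast
qed

section \<open>Rows and kernel of a graph Laplacian\<close>

lemma laplacian_carrier: "laplacian n E \<in> carrier_mat n n"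
  by (simp add: laplacian_def)

lemma laplacian_mult_vec_index:
  assumes "irreflp E" "v \<in> carrier_vec n" "i < n"
  shows "(laplacian n E *\<^sub>v v) $ i = (\<Sum>b | b \<in> {1..n} \<and> E (Suc i) b. v $ i - v $ (b - 1))"
proof -
  \<comment> \<open>Irreflexivity makes the adjacency part vanish at \<open>j = i\<close>, so it can
    be summed without singling out the diagonal.\<close>
  have "(laplacian n E *\<^sub>v v) $ i
    = (\<Sum>j<n. (if i = j then real (card {b \<in> {1..n}. E (Suc i) b}) * v $ i else 0)
         - (if E (Suc i) (Suc j) then v $ j else 0))"
    using assms irreflpD[of E "Suc i"] by (auto simp: laplacian_def scalar_prod_def lessThan_atLeast0 intro!: sum.cong)
  also have "\<dots> = real (card {b \<in> {1..n}. E (Suc i) b}) * v $ i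
      - (\<Sum>j<n. if E (Suc i) (Suc j) then v $ j else 0)"
    using assms by (simp add: sum_subtractf)
  also have "(\<Sum>j<n. if E (Suc i) (Suc j) then v $ j else 0)
      = (\<Sum>b\<in>{1..n}. if E (Suc i) b then v $ (b - 1) else 0)"
    by (rule sum.reindex_bij_witness[of _ "\<lambda>b. b - 1" Suc]) auto
  also have "\<dots> = (\<Sum>b | b \<in> {1..n} \<and> E (Suc i) b. v $ (b - 1))"
    by (simp flip: sum.inter_filter)
  finally show ?thesis by (simp add: sum_subtractf)
qed

lemma transpose_laplacian:
  assumes "symp E"
  shows "transpose_mat (laplacian n E) = laplacian n E"
  using assms by (intro eq_matI) (auto simp: laplacian_def dest: sympD)

text \<open>Discrete maximum principle: at a maximum the row of the equation is a vanishing sum of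
  nonnegative differences, so each of them is zero.\<close>

lemma laplacian_kernel_maximum:
  assumes irr: "irreflp E" and v: "v \<in> carrier_vec n" and L0: "laplacian n E *\<^sub>v v = 0\<^sub>v n"
    and i: "i < n" and max: "\<And>l. l < n \<Longrightarrow> v $ l \<le> v $ i"
    and j: "j < n" "E (Suc i) (Suc j)"
  shows "v $ j = v $ i"
proof -
  have "(\<Sum>b | b \<in> {1..n} \<and> E (Suc i) b. v $ i - v $ (b - 1)) = 0"
    using laplacian_mult_vec_index[OF irr v i] L0 i by simp
  then have "\<forall>b\<in>{b \<in> {1..n}. E (Suc i) b}. v $ i - v $ (b - 1) = 0"
    by (subst (asm) sum_nonneg_eq_0_iff) (auto intro: max)
  with j show ?thesis by force
qed

text \<open>By \<open>suc\<close> the graph contains the path through all vertices in order; the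
  maximal value spreads along it in both directions.\<close>

lemma laplacian_kernel_constant:
  assumes irr: "irreflp E" and sym: "symp E" and suc: "\<forall>a. E a (Suc a)"
    and v: "v \<in> carrier_vec n" and L0: "laplacian n E *\<^sub>v v = 0\<^sub>v n"
    and "i < n" "j < n"
  shows "v $ i = v $ j"
proof -
  define M where "M = Max (($) v ` {..<n})"
  have fin: "finite (($) v ` {..<n})" "($) v ` {..<n} \<noteq> {}" using \<open>i < n\<close> by auto
  have le: "v $ l \<le> M" if "l < n" for l
    using that fin by (simp add: M_def)
  obtain p where p: "p < n" "v $ p = M"
    using Max_in[OF fin] unfolding M_def[symmetric] by auto
  have step_max: "v $ b = M" if "v $ a = M" "a < n" "b < n" "E (Suc a) (Suc b)" for a b
    using laplacian_kernel_maximum[OF irr v L0, of a b] that le by simp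
  have up: "v $ l = M" if "p \<le> l" "l < n" for l
    using that
  proof (induction l rule: dec_induct)
    case (step l)
    then show ?case using step_max[of l "Suc l"] suc by simp
  qed (rule p(2))
  have down: "v $ l = M" if "l \<le> p" for l
    using that
  proof (induction l rule: inc_induct)
    case (step l)
    then show ?case using step_max[of "Suc l" l] p(1) sympD[OF sym] suc by simp
  qed (rule p(2))
  have "v $ l = M" if "l < n" for l
    using up[of l] down[of l] that by linarith
  then show ?thesis using assms by simp
qed

text \<open>The kernel consists of the constant vectors, so the projection onto it is the averaging
  matrix with all entries \<open>1 / n\<close>.\<close>

lemma moore_penrose_laplacian:
  assumes irr: "irreflp E" and sym: "symp E" and suc: "\<forall>a. E a (Suc a)"
    and n: "n > 0"
  defines "G \<equiv> moore_penrose (laplacian n E)"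
  shows "G \<in> carrier_mat n n" "transpose_mat G = G"
    "G * laplacian n E = 1\<^sub>m n - mat n n (\<lambda>_. 1 / real n)"
proof -
  let ?L = "laplacian n E"
  let ?J = "mat n n (\<lambda>_. 1 / real n)"
  have row: "(?L *\<^sub>v vec n (\<lambda>_. 1 / real n)) $ i = 0" if "i < n" for i
    using that by (subst laplacian_mult_vec_index[OF irr]) (auto intro!: sum.neutral)
  have 1: "?L * ?J = 0\<^sub>m n n"
  proof (rule eq_matI)
    fix i j assume "i < dim_row (0\<^sub>m n n :: real mat)" "j < dim_col (0\<^sub>m n n :: real mat)"
    moreover have "col ?J j = vec n (\<lambda>_. 1 / real n)" if "j < n" using that by auto
    ultimately show "(?L * ?J) $$ (i, j) = 0\<^sub>m n n $$ (i, j)"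
      using row[of i] by (simp add: laplacian_def)
  qed (auto simp: laplacian_def)
  have 2: "?J * ?J = ?J"
    using n by (auto simp: scalar_prod_def)
  have 3: "transpose_mat ?J = ?J" by auto
  have 4: "v = 0\<^sub>v n" if v: "v \<in> carrier_vec n" and "?L *\<^sub>v v = 0\<^sub>v n" and Jv: "?J *\<^sub>v v = 0\<^sub>v n" for v
  proof -
    define c where "c = v $ 0"
    have const: "v $ i = c" if "i < n" for i
      unfolding c_def
      using laplacian_kernel_constant[OF irr sym suc v] that n \<open>?L *\<^sub>v v = 0\<^sub>v n\<close> by blast
    have "(?J *\<^sub>v v) $ 0 = 0" using Jv n by simp
    then have "(\<Sum>i<n. v $ i / real n) = 0"
      using n v by (simp add: scalar_prod_def lessThan_atLeast0)
    then have "c = 0" using const n by simp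
    then show ?thesis using v const by auto
  qed
  obtain X where X: "is_moore_penrose ?L X" "X \<in> carrier_mat n n" "transpose_mat X = X"
      "X * ?L = 1\<^sub>m n - ?J"
    by (rule moore_penrose_of_kernel_projection[OF laplacian_carrier _ transpose_laplacian[OF sym] 3 2 1 4])
      simp_all
  then have "G = X" unfolding G_def by (intro moore_penrose_eqI)
  with X show "G \<in> carrier_mat n n" "transpose_mat G = G"
    "G * ?L = 1\<^sub>m n - ?J" by simp_all
qed

text \<open>With \<open>x\<close>, \<open>y\<close> the two dipole vectors and \<open>G\<close> the symmetric pseudoinverse,
  \<open>x\<^sup>T G x - y\<^sup>T G y = (x + y)\<^sup>T G (x - y)\<close>, so only a potential for \<open>x - y\<close> is needed.\<close>

lemma resistance_distance_diff:
  assumes irr: "irreflp E" and sym: "symp E" and suc: "\<forall>a. E a (Suc a)"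
    and abcd: "a \<in> {1..n}" "b \<in> {1..n}" "c \<in> {1..n}" "d \<in> {1..n}"
    and w: "w \<in> carrier_vec n"
    and Lw: "laplacian n E *\<^sub>v w =
      (unit_vec n (a - 1) - unit_vec n (b - 1)) - (unit_vec n (c - 1) - unit_vec n (d - 1))"
  shows "resistance_distance n E a b - resistance_distance n E c d =
    w $ (a - 1) - w $ (b - 1) + w $ (c - 1) - w $ (d - 1)"
proof -
  have n: "n > 0" using abcd by auto
  define G where "G = moore_penrose (laplacian n E)"
  note G = moore_penrose_laplacian[OF irr sym suc n, folded G_def]
  define x where "x = (unit_vec n (a - 1) - unit_vec n (b - 1) :: real vec)"
  define y where "y = (unit_vec n (c - 1) - unit_vec n (d - 1) :: real vec)"
  let ?J = "mat n n (\<lambda>_. 1 / real n)"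
  have x: "x \<in> carrier_vec n" and y: "y \<in> carrier_vec n" by (auto simp: x_def y_def)
  have Gx: "G *\<^sub>v x \<in> carrier_vec n" and Gy: "G *\<^sub>v y \<in> carrier_vec n"
    using G(1) x y by auto
  have xy: "x \<bullet> (G *\<^sub>v y) = y \<bullet> (G *\<^sub>v x)"
    using transpose_vec_mult_scalar[OF G(1) y x] comm_scalar_prod[OF Gx y] G(2) by simp
  have dot: "x \<bullet> u = u $ (a - 1) - u $ (b - 1)" "y \<bullet> u = u $ (c - 1) - u $ (d - 1)"
    if "u \<in> carrier_vec n" for u
    using that abcd by (auto simp: x_def y_def minus_scalar_prod_distrib[of _ n])
  have "G *\<^sub>v (x - y) = (G * laplacian n E) *\<^sub>v w"
    unfolding x_def y_def Lw[symmetric]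
    by (rule assoc_mult_mat_vec[OF G(1) laplacian_carrier w, symmetric])
  also have "\<dots> = (1\<^sub>m n - ?J) *\<^sub>v w" by (simp only: G(3))
  also have "\<dots> = w - ?J *\<^sub>v w"
    using w by (simp add: minus_mult_distrib_mat_vec[of _ n n])
  finally have Gxy: "G *\<^sub>v (x - y) = w - ?J *\<^sub>v w" .
  have "resistance_distance n E a b - resistance_distance n E c d = x \<bullet> (G *\<^sub>v x) - y \<bullet> (G *\<^sub>v y)"
    by (simp add: resistance_distance_def Let_def x_def y_def G_def)
  also have "\<dots> = x \<bullet> (G *\<^sub>v (x - y)) + y \<bullet> (G *\<^sub>v (x - y))"
    using xy x y Gx Gy by (simp add: mult_minus_distrib_mat_vec[OF G(1)] scalar_prod_minus_distrib[of _ n])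
  also have "\<dots> = w $ (a - 1) - w $ (b - 1) + w $ (c - 1) - w $ (d - 1)"
  proof -
    \<comment> \<open>\<open>?J\<close> maps \<open>w\<close> to a constant vector, and the constant
      cancels in the differences of \<open>dot\<close>.\<close>
    have "(w - ?J *\<^sub>v w) $ i = w $ i - (\<Sum>l = 0..<n. w $ l / real n)" if "i < n" for i
      using that w by (simp add: scalar_prod_def)
    moreover have "w - ?J *\<^sub>v w \<in> carrier_vec n" using w by (intro carrier_vecI) simp
    moreover have "a - 1 < n" "b - 1 < n" "c - 1 < n" "d - 1 < n" using abcd by auto
    ultimately show ?thesis unfolding Gxy by (simp only: dot)
  qed
  finally show ?thesis .
qed

section \<open>Dipole potentials of the straight linear 2-tree\<close>

text \<open>This is the Laplacian of the infinite strip on all integers. Working there turns the two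
  ends of the finite graph into reflection conditions.\<close>

definition harmonic_at :: "(int \<Rightarrow> real) \<Rightarrow> int \<Rightarrow> real" where
  "harmonic_at f i = 4 * f i - f (i - 2) - f (i - 1) - f (i + 1) - f (i + 2)"

definition \<theta> :: real where "\<theta> = arsinh (1 / 2)"

section \<open>Hyperbolic values at multiples of \<theta>\<close>

lemma sinh_\<theta>: "sinh \<theta> = 1 / 2"
  by (simp add: \<theta>_def)

lemma \<theta>_pos: "\<theta> > 0"
  using sinh_\<theta> sinh_real_pos_iff by fastforce

lemma cosh_2\<theta>: "cosh (2 * \<theta>) = 3 / 2"
  using cosh_square_eq[of \<theta>] by (simp add: cosh_double sinh_\<theta> power2_eq_square)

lemma cosh_4\<theta>: "cosh (4 * \<theta>) = 7 / 2"
  using cosh_double_cosh[of "2 * \<theta>"] by (simp add: cosh_2\<theta> power2_eq_square)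

lemma sinh_3\<theta>: "sinh (3 * \<theta>) = 2"
proof -
  have "sinh (3 * \<theta>) = sinh (2 * \<theta> + \<theta>)" by (simp add: algebra_simps)
  also have "\<dots> = 2 * sinh \<theta> * (cosh \<theta>)\<^sup>2 + 3 / 2 * sinh \<theta>"
    by (simp only: sinh_add sinh_double cosh_2\<theta>) (simp add: power2_eq_square)
  finally show ?thesis by (simp add: cosh_square_eq sinh_\<theta>) (simp add: power2_eq_square)
qed

text \<open>A combination of the powers of -\<phi>^2 and -\<phi>^(-2), centred at
  \<open>- c / 2\<close>: \<open>c = - 2\<close> centres it at vertex 1, \<open>c = - 2 * n\<close>
  at vertex \<open>n\<close>.\<close>

definition alt_cosh :: "int \<Rightarrow> int \<Rightarrow> real" where
  "alt_cosh c i = (-1) powi i * cosh (real_of_int (2 * i + c) * \<theta>)"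

text \<open>Opposite shifts add up to \<open>7 * cosh x\<close> and \<open>3 * cosh x\<close>, with
  opposite signs, and 4 - 7 + 3 = 0.\<close>

lemma alt_cosh_harmonic:
  "harmonic_at (\<lambda>i. a * alt_cosh c i + b) i = 0"
proof -
  define x where "x = real_of_int (2 * i + c) * \<theta>"
  have *: "cosh (x + 4 * \<theta>) + cosh (x - 4 * \<theta>) = 7 * cosh x"
    "cosh (x + 2 * \<theta>) + cosh (x - 2 * \<theta>) = 3 * cosh x"
    by (simp_all add: cosh_add cosh_diff cosh_4\<theta> cosh_2\<theta>)
  have "alt_cosh c (i + 2) = (-1) powi i * cosh (x + 4 * \<theta>)"
    "alt_cosh c (i - 2) = (-1) powi i * cosh (x - 4 * \<theta>)"
    "alt_cosh c (i + 1) = - ((-1) powi i) * cosh (x + 2 * \<theta>)"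
    "alt_cosh c (i - 1) = - ((-1) powi i) * cosh (x - 2 * \<theta>)"
    "alt_cosh c i = (-1) powi i * cosh x"
    by (simp_all add: alt_cosh_def x_def power_int_add power_int_diff algebra_simps)
  then have "harmonic_at (\<lambda>i. a * alt_cosh c i + b) i =
     a * (-1) powi i * (4 * cosh x - (cosh (x + 4 * \<theta>) + cosh (x - 4 * \<theta>))
       + (cosh (x + 2 * \<theta>) + cosh (x - 2 * \<theta>)))"
    by (simp add: harmonic_at_def algebra_simps)
  then show ?thesis by (simp add: *)
qed

text \<open>A potential with a unit dipole at \<open>s\<close>, \<open>s + 1\<close> arises by gluing two harmonic functions that
  agree at the two poles and differ by 1 at the next vertex on either side.\<close>

lemma harmonic_at_glue:
  assumes P: "\<And>i. harmonic_at P i = 0" and Q: "\<And>i. harmonic_at Q i = 0"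
    and "Q s = P s" "Q (s + 1) = P (s + 1)" "Q (s + 2) = P (s + 2) + 1" "Q (s - 1) = P (s - 1) + 1"
  shows "harmonic_at (\<lambda>i. if i \<le> s then P i else Q i) i =
    (if i = s + 1 then 1 else if i = s then - 1 else 0)"
proof -
  \<comment> \<open>Only the four rows from \<open>s - 1\<close> to \<open>s + 2\<close> meet both
    functions.\<close>
  consider "i \<le> s - 2" | "i = s - 1" | "i = s" | "i = s + 1" | "i = s + 2" | "i \<ge> s + 3" by linarith
  then show ?thesis
    using assms(3-6) P[of i] Q[of i] by cases (auto simp: harmonic_at_def add.commute)
qed

lemma cosh_mult_cosh:
  fixes x y :: real
  shows "cosh x * cosh y = (cosh (x + y) + cosh (x - y)) / 2"
  by (simp add: cosh_add cosh_diff)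

lemma cosh_mult_sinh:
  fixes x y :: real
  shows "cosh x * sinh y = (sinh (x + y) - sinh (x - y)) / 2"
  by (simp add: sinh_add sinh_diff)

lemma cosh_diff_cosh:
  fixes x y :: real
  shows "cosh (x + y) - cosh (x - y) = 2 * sinh x * sinh y"
  by (simp add: cosh_add cosh_diff)

text \<open>The summand 0 gives \<open>dipole_left\<close> the shape \<open>a * alt_cosh c i + b\<close> of \<open>dipole_right\<close>.\<close>

definition dipole_left :: "int \<Rightarrow> int \<Rightarrow> int \<Rightarrow> real" where
  "dipole_left n s i = - (2 / 5) * (-1) powi s * cosh (real_of_int (2 * n - 2 * s - 1) * \<theta>)
     / sinh (real_of_int (2 * n - 2) * \<theta>) * alt_cosh (- 2) i + 0"

text \<open>Up to sign and the constant 1/5 this is the mirror image of \<open>dipole_left\<close>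
  under \<open>i\<close> to \<open>n + 1 - i\<close> and \<open>s\<close> to
  \<open>n - s\<close>.\<close>

definition dipole_right :: "int \<Rightarrow> int \<Rightarrow> int \<Rightarrow> real" where
  "dipole_right n s i = - (2 / 5) * (-1) powi s * cosh (real_of_int (2 * s - 1) * \<theta>)
     / sinh (real_of_int (2 * n - 2) * \<theta>) * alt_cosh (- 2 * n) i + 1 / 5"

definition dipole :: "int \<Rightarrow> int \<Rightarrow> int \<Rightarrow> real" where
  "dipole n s i = (if i \<le> s then dipole_left n s i else dipole_right n s i)"

text \<open>Both products of cosh contain the same term \<open>cosh (v + \<theta>)\<close>, which
  cancels; the rest has the factor \<open>sinh A\<close> of the denominator. So the jump depends on
  \<open>d\<close> alone.\<close>

lemma dipole_jump:
  assumes "n \<ge> 2"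
  shows "dipole_right n s (s + d) - dipole_left n s (s + d) =
    1 / 5 + 2 / 5 * (-1) powi d * sinh (real_of_int (2 * d - 1) * \<theta>)"
proof -
  define A where "A = real_of_int (2 * n - 2) * \<theta>"
  have "A > 0" using assms \<theta>_pos by (simp add: A_def)
  then have A: "sinh A \<noteq> 0" by simp
  define u v where "u = real_of_int (2 * d - 1) * \<theta>" and "v = real_of_int (2 * n - 4 * s - 2 * d) * \<theta>"
  have sq: "(-1) powi s * (-1) powi s = (1::real)"
    by (simp add: power_int_mult_distrib[symmetric])
  have 1: "cosh (real_of_int (2 * n - 2 * s - 1) * \<theta>) * cosh (real_of_int (2 * (s + d) - 2) * \<theta>)
     = (cosh (A + u) + cosh (v + \<theta>)) / 2"
    by (subst cosh_mult_cosh) (auto simp: A_def u_def v_def algebra_simps)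
  have 2: "cosh (real_of_int (2 * s - 1) * \<theta>) * cosh (real_of_int (2 * (s + d) - 2 * n) * \<theta>)
     = (cosh (A - u) + cosh (v + \<theta>)) / 2"
    by (subst cosh_mult_cosh, subst (4) cosh_minus[symmetric])
      (auto simp: A_def u_def v_def algebra_simps)
  have "dipole_right n s (s + d) - dipole_left n s (s + d) = 1 / 5 + 2 / 5 / sinh A * (-1) powi d *
    ((-1) powi s * (-1) powi s) *
    (cosh (real_of_int (2 * n - 2 * s - 1) * \<theta>) * cosh (real_of_int (2 * (s + d) - 2) * \<theta>)
     - cosh (real_of_int (2 * s - 1) * \<theta>) * cosh (real_of_int (2 * (s + d) - 2 * n) * \<theta>))"
    (is "_ = 1 / 5 + 2 / 5 / _ * _ * _ * (?c1 * ?c2 - ?c3 * ?c4)")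
  proof -
    have "alt_cosh (- 2) (s + d) = (-1) powi s * (-1) powi d * ?c2"
      "alt_cosh (- 2 * n) (s + d) = (-1) powi s * (-1) powi d * ?c4"
      by (simp_all add: alt_cosh_def power_int_add)
    moreover have "1 / 5 + 2 / 5 / a * e * (t * t) * (p * q - x * y)
        = - (2 / 5) * t * x / a * (t * e * y) + 1 / 5 - (- (2 / 5) * t * p / a * (t * e * q) + 0)"
      for a e t p q x y :: real
      by (cases "a = 0") (auto simp: field_simps)
    ultimately show ?thesis
      unfolding dipole_right_def dipole_left_def A_def by (simp only:)
  qed
  also have "\<dots> = 1 / 5 + 1 / 5 / sinh A * (-1) powi d * (cosh (A + u) - cosh (A - u))"
    unfolding 1 2 sq by (simp add: diff_divide_distrib[symmetric])
  also have "\<dots> = 1 / 5 + 2 / 5 * (-1) powi d * sinh u"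
    unfolding cosh_diff_cosh using A by (simp add: field_simps)
  finally show ?thesis by (simp add: u_def)
qed

text \<open>With \<open>sinh \<theta> = 1 / 2\<close> and \<open>sinh (3 * \<theta>) = 2\<close>,
  the constants 1/5 and 2/5 give jump 0 at \<open>d = 0, 1\<close> and jump 1 at
  \<open>d = 2, - 1\<close>.\<close>

lemma dipole_overlap:
  assumes "n \<ge> 2"
  shows "dipole_right n s s = dipole_left n s s"
    "dipole_right n s (s + 1) = dipole_left n s (s + 1)"
    "dipole_right n s (s + 2) = dipole_left n s (s + 2) + 1"
    "dipole_right n s (s - 1) = dipole_left n s (s - 1) + 1"
  using dipole_jump[OF assms, of s 0] dipole_jump[OF assms, of s 1]
    dipole_jump[OF assms, of s 2] dipole_jump[OF assms, of s "- 1"]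
  by (simp_all add: sinh_\<theta> sinh_3\<theta>)

lemma dipole_harmonic:
  assumes "n \<ge> 2"
  shows "harmonic_at (dipole n s) i = (if i = s + 1 then 1 else if i = s then - 1 else 0)"
  unfolding dipole_def[abs_def]
  by (intro harmonic_at_glue dipole_overlap assms) (simp_all only: dipole_left_def dipole_right_def alt_cosh_harmonic)

section \<open>Reflections at the two ends\<close>

lemma alt_cosh_reflect:
  "alt_cosh (- 2 * c) (c + d) = alt_cosh (- 2 * c) (c - d)"
proof -
  have "cosh (real_of_int (2 * (c + d) + - 2 * c) * \<theta>) = cosh (real_of_int (2 * (c - d) + - 2 * c) * \<theta>)"
    by (subst cosh_minus[symmetric]) (simp add: algebra_simps)
  then show ?thesis by (simp add: alt_cosh_def power_int_minus_one_mult_self power_int_add power_int_diff divide_simps)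
qed

lemma alt_cosh_reflect2:
  "alt_cosh (- 2 * c) (c + 1) + alt_cosh (- 2 * c) (c + 2) = 2 * alt_cosh (- 2 * c) c"
  by (simp add: alt_cosh_def power_int_add cosh_2\<theta> cosh_4\<theta>)

text \<open>The branches agree at both poles, so each remains valid one vertex across the seam; sums
  over adjacent vertices then need only one branch.\<close>

lemma dipole_eq_left:
  assumes "n \<ge> 2" "i \<le> s + 1"
  shows "dipole n s i = dipole_left n s i"
  using assms dipole_overlap(2)[of n s] by (cases "i = s + 1") (auto simp: dipole_def)

lemma dipole_eq_right:
  assumes "n \<ge> 2" "i \<ge> s"
  shows "dipole n s i = dipole_right n s i"
  using assms dipole_overlap(1)[of n s] by (cases "i = s") (auto simp: dipole_def)

text \<open>These reflections make the terms of \<open>harmonic_at\<close> outside \<open>{1..n}\<close> cancel, so that on the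
  boundary rows it is still the Laplacian.\<close>

lemma dipole_boundary:
  assumes "1 \<le> s" "s < n"
  shows "dipole n s 0 = dipole n s 2" "dipole n s 0 + dipole n s (- 1) = 2 * dipole n s 1"
    "dipole n s (n + 1) = dipole n s (n - 1)" "dipole n s (n + 1) + dipole n s (n + 2) = 2 * dipole n s n"
proof -
  have n: "n \<ge> 2" using assms by simp
  note l = dipole_eq_left[OF n] and r = dipole_eq_right[OF n]
  show "dipole n s 0 = dipole n s 2"
    using alt_cosh_reflect[of 1 1] assms by (simp add: l dipole_left_def)
  have e: "(a * x + b) + (a * y + b) = 2 * (a * z + b)" if "x + y = 2 * z" for a b x y z :: real
    using arg_cong[OF that, of "(*) a"] by (simp add: algebra_simps)
  have "alt_cosh (- 2) 0 + alt_cosh (- 2) (- 1) = 2 * alt_cosh (- 2) 1"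
    using alt_cosh_reflect2[of 1] alt_cosh_reflect[of 1 1] alt_cosh_reflect[of 1 2] by simp
  then show "dipole n s 0 + dipole n s (- 1) = 2 * dipole n s 1"
    using assms by (simp only: l dipole_left_def e)
  show "dipole n s (n + 1) = dipole n s (n - 1)"
    using alt_cosh_reflect[of n 1] assms by (simp add: r dipole_right_def)
  show "dipole n s (n + 1) + dipole n s (n + 2) = 2 * dipole n s n"
    using assms by (simp only: r dipole_right_def e[OF alt_cosh_reflect2])
qed

text \<open>Neighbouring values have opposite signs, so their sum is a difference of cosh at
  \<open>x + \<theta>\<close> and \<open>x - \<theta>\<close>.\<close>

lemma alt_cosh_add_Suc:
  "alt_cosh c i + alt_cosh c (i + 1) = - ((-1) powi i) * sinh (real_of_int (2 * i + c + 1) * \<theta>)"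
proof -
  define x where "x = real_of_int (2 * i + c + 1) * \<theta>"
  have "alt_cosh c i + alt_cosh c (i + 1) = - ((-1) powi i) * (cosh (x + \<theta>) - cosh (x - \<theta>))"
    by (simp add: alt_cosh_def power_int_add x_def algebra_simps)
  then show ?thesis unfolding cosh_diff_cosh by (simp add: sinh_\<theta> x_def)
qed

text \<open>The increments of \<open>g\<close> involve potentials only through sums over adjacent
  vertices. At \<open>i = s\<close> both formulas apply.\<close>

lemma dipole_add_Suc:
  assumes "n \<ge> 2"
  shows "i \<le> s \<Longrightarrow> dipole n s i + dipole n s (i + 1) =
      2 / 5 * (-1) powi (s + i) * cosh (real_of_int (2 * n - 2 * s - 1) * \<theta>)
        * sinh (real_of_int (2 * i - 1) * \<theta>) / sinh (real_of_int (2 * n - 2) * \<theta>)"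
    and "s \<le> i \<Longrightarrow> dipole n s i + dipole n s (i + 1) = 2 / 5 -
      2 / 5 * (-1) powi (s + i) * cosh (real_of_int (2 * s - 1) * \<theta>)
        * sinh (real_of_int (2 * n - 2 * i - 1) * \<theta>) / sinh (real_of_int (2 * n - 2) * \<theta>)"
proof -
  have e: "(a * x + b) + (a * y + b) = a * (x + y) + 2 * b" for a b x y :: real
    by (simp add: algebra_simps)
  show "dipole n s i + dipole n s (i + 1) =
      2 / 5 * (-1) powi (s + i) * cosh (real_of_int (2 * n - 2 * s - 1) * \<theta>)
        * sinh (real_of_int (2 * i - 1) * \<theta>) / sinh (real_of_int (2 * n - 2) * \<theta>)" if "i \<le> s"
  proof -
    have "dipole n s i + dipole n s (i + 1) = dipole_left n s i + dipole_left n s (i + 1)"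
      using that assms by (simp add: dipole_eq_left)
    then show ?thesis
      unfolding dipole_left_def e alt_cosh_add_Suc by (simp add: power_int_add)
  qed
  show "dipole n s i + dipole n s (i + 1) = 2 / 5 -
      2 / 5 * (-1) powi (s + i) * cosh (real_of_int (2 * s - 1) * \<theta>)
        * sinh (real_of_int (2 * n - 2 * i - 1) * \<theta>) / sinh (real_of_int (2 * n - 2) * \<theta>)" if "s \<le> i"
  proof -
    have "sinh (real_of_int (2 * i + - 2 * n + 1) * \<theta>) = - sinh (real_of_int (2 * n - 2 * i - 1) * \<theta>)"
      by (subst sinh_minus[symmetric]) (simp add: algebra_simps)
    moreover have "dipole n s i + dipole n s (i + 1) = dipole_right n s i + dipole_right n s (i + 1)"
      using that assms by (simp add: dipole_eq_right)
    ultimately show ?thesis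
      unfolding dipole_right_def e alt_cosh_add_Suc by (simp add: power_int_add)
  qed
qed

section \<open>The Laplacian of the straight linear 2-tree\<close>

text \<open>Row 1 lacks the neighbours 0 and -1, row 2 lacks 0; the hypotheses make the differences
  that \<open>harmonic_at\<close> adds for them cancel. The other end is alike.\<close>

lemma straight_2tree_laplacian:
  assumes n: "n \<ge> 3" and i: "i < n"
    and f: "f 0 = f 2" "f 0 + f (- 1) = 2 * f 1"
      "f (int n + 1) = f (int n - 1)" "f (int n + 1) + f (int n + 2) = 2 * f (int n)"
  shows "(laplacian n straight_2tree_adj *\<^sub>v vec n (\<lambda>i. f (int i + 1))) $ i = harmonic_at f (int i + 1)"
proof -
  define a where "a = int i + 1"
  have a: "1 \<le> a" "a \<le> int n" using i by (auto simp: a_def)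
  have "(laplacian n straight_2tree_adj *\<^sub>v vec n (\<lambda>i. f (int i + 1))) $ i
    = (\<Sum>b | b \<in> {1..n} \<and> straight_2tree_adj (Suc i) b. f a - f (int b))"
    using i by (subst laplacian_mult_vec_index)
      (auto simp: a_def irreflp_def straight_2tree_adj_def of_nat_diff intro!: sum.cong)
  also have "\<dots> = (\<Sum>d | d \<in> {-2, -1, 1, 2} \<and> 1 \<le> a + d \<and> a + d \<le> int n. f a - f (a + d))"
    by (rule sum.reindex_bij_witness[of _ "\<lambda>d. nat (a + d)" "\<lambda>b. int b - a"])
      (auto simp: straight_2tree_adj_def a_def)
  also have "\<dots> = (\<Sum>d\<in>{-2, -1, 1, 2}. if 1 \<le> a + d \<and> a + d \<le> int n then f a - f (a + d) else 0)"
    by (rule sum.inter_filter) simp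
  also have "\<dots> = harmonic_at f a"
  proof -
    \<comment> \<open>Treating left and right neighbours separately avoids extra cases for vertices
      near both ends.\<close>
    have l: "(if 1 \<le> a - 2 then f a - f (a - 2) else 0) + (if 1 \<le> a - 1 then f a - f (a - 1) else 0)
        = 2 * f a - f (a - 2) - f (a - 1)"
    proof -
      consider "a = 1" | "a = 2" | "a \<ge> 3" using a by linarith
      then show ?thesis using f by cases auto
    qed
    have r: "(if a + 1 \<le> int n then f a - f (a + 1) else 0) + (if a + 2 \<le> int n then f a - f (a + 2) else 0)
        = 2 * f a - f (a + 1) - f (a + 2)"
    proof -
      consider "a = int n" | "a = int n - 1" | "a \<le> int n - 2" using a by linarith
      then show ?thesis using f by cases (auto simp: add.commute)
    qed
    have "(\<Sum>d\<in>{-2, -1, 1, 2}. if 1 \<le> a + d \<and> a + d \<le> int n then f a - f (a + d) else 0)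
        = (2 * f a - f (a - 2) - f (a - 1)) + (2 * f a - f (a + 1) - f (a + 2))"
      unfolding l[symmetric] r[symmetric] using a by simp
    then show ?thesis by (simp add: harmonic_at_def)
  qed
  finally show ?thesis by (simp add: a_def)
qed

text \<open>Indices start at 0: the entries \<open>s\<close> and \<open>s - 1\<close> belong to the
  vertices \<open>s + 1\<close> and \<open>s\<close>.\<close>

lemma laplacian_dipole:
  assumes "n \<ge> 3" "1 \<le> s" "s < n"
  shows "laplacian n straight_2tree_adj *\<^sub>v vec n (\<lambda>i. dipole (int n) (int s) (int i + 1))
    = unit_vec n s - unit_vec n (s - 1)"
proof (rule eq_vecI)
  fix i assume "i < dim_vec (unit_vec n s - unit_vec n (s - 1) :: real vec)"
  then have "i < n" by simp
  then show "(laplacian n straight_2tree_adj *\<^sub>v vec n (\<lambda>i. dipole (int n) (int s) (int i + 1))) $ i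
    = (unit_vec n s - unit_vec n (s - 1)) $ i"
    using assms dipole_boundary[of "int s" "int n"]
    by (subst straight_2tree_laplacian) (auto simp: dipole_harmonic unit_vec_def)
qed (simp add: laplacian_def)

section \<open>Closed form of the resistance profile\<close>

text \<open>The difference of the two long dipoles regroups into the short dipole at
  \<open>j\<close> minus the short dipole at \<open>j + k\<close>, so \<open>V j - V (j + k)\<close>
  is the potential that \<open>resistance_distance_diff\<close> asks for.\<close>

lemma g_Suc_dipole:
  assumes n: "n = m + 2" "n \<ge> 3" and "1 \<le> k" "1 \<le> j" "j + k < n"
  defines "V \<equiv> \<lambda>s i. dipole (int n) (int s) (int i)"
  shows "g k m (j + 1) - g k m j =
    (V j j + V j (j + 1)) - (V j (j + k) + V j (j + k + 1))
    - (V (j + k) j + V (j + k) (j + 1)) + (V (j + k) (j + k) + V (j + k) (j + k + 1))"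
proof -
  define d where "d s = vec n (\<lambda>i. dipole (int n) (int s) (int i + 1))" for s
  have d: "d s \<in> carrier_vec n" for s by (simp add: d_def)
  let ?L = "laplacian n straight_2tree_adj"
  have Ld: "?L *\<^sub>v d s = unit_vec n s - unit_vec n (s - 1)" if "1 \<le> s" "s < n" for s
    using laplacian_dipole[OF n(2) that] by (simp add: d_def)
  have "?L *\<^sub>v (d j - d (j + k)) = ?L *\<^sub>v d j - ?L *\<^sub>v d (j + k)"
    by (rule mult_minus_distrib_mat_vec[OF laplacian_carrier d d])
  also have "\<dots> = (unit_vec n (j + 1 - 1) - unit_vec n (j + 1 + k - 1))
      - (unit_vec n (j - 1) - unit_vec n (j + k - 1))"
    using assms by (subst (1 2) Ld) (auto intro!: eq_vecI)
  finally have "resistance_distance n straight_2tree_adj (j + 1) (j + 1 + k)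
      - resistance_distance n straight_2tree_adj j (j + k)
      = (d j - d (j + k)) $ (j + 1 - 1) - (d j - d (j + k)) $ (j + 1 + k - 1)
        + (d j - d (j + k)) $ (j - 1) - (d j - d (j + k)) $ (j + k - 1)"
    using assms d
    by (intro resistance_distance_diff)
      (auto simp: irreflp_def symp_def straight_2tree_adj_def)
  moreover have "d s $ i = V s (i + 1)" if "i < n" for s i
    using that by (simp add: d_def V_def add.commute)
  ultimately show ?thesis
    using assms(3-5) d unfolding g_def r_def n(1)[symmetric]
    by (simp add: d_def V_def of_nat_diff algebra_simps)
qed

lemma g_Suc:
  assumes n: "n = m + 2" "n \<ge> 3" and k: "1 \<le> k" "1 \<le> j" "j + k < n"
  shows "g k m (j + 1) - g k m j =
    2 / 5 * (cosh (2 * real k * \<theta>) - (-1) ^ k) / sinh ((2 * real n - 2) * \<theta>)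
      * sinh (2 * (2 * real j + real k - real n) * \<theta>)"
proof -
  define S where "S = sinh ((2 * real n - 2) * \<theta>)"
  define x where "x = real j * \<theta>"
  define u where "u = real (j + k) * \<theta>"
  define N where "N = real n * \<theta>"
  define K where "K = 2 * u - 2 * x"
  define T where "T = 2 * u + 2 * x - 2 * N"
  have e: "(-1) powi (int j + int j) = (1::real)" "(-1) powi (int (j + k) + int (j + k)) = (1::real)"
     "(-1) powi (int j + int (j + k)) = ((-1) ^ k :: real)"  "(-1) powi (int (j + k) + int j) = ((-1) ^ k :: real)"
    by (simp_all add: power_int_add power_add flip: power_mult_distrib)
  have th: "real_of_int (2 * int n - 2 * int s - 1) * \<theta> = 2 * N - 2 * (real s * \<theta>) - \<theta>"
     "real_of_int (2 * int s - 1) * \<theta> = 2 * (real s * \<theta>) - \<theta>"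
     "real_of_int (2 * int n - 2) * \<theta> = (2 * real n - 2) * \<theta>" for s
    by (simp_all add: N_def algebra_simps)
  have n2: "int n \<ge> 2" and le: "int j \<le> int (j + k)" using n by simp_all
  \<comment> \<open>Taking the second formula at \<open>s = i = j\<close> lets the two constants 2/5
    cancel.\<close>
  note sums = dipole_add_Suc(2)[OF n2 order_refl, of "int j", unfolded e th, folded x_def S_def]
    dipole_add_Suc(2)[OF n2 le, unfolded e th, folded x_def u_def S_def]
    dipole_add_Suc(1)[OF n2 le, unfolded e th, folded x_def u_def S_def]
    dipole_add_Suc(1)[OF n2 order_refl, of "int (j + k)", unfolded e th, folded u_def S_def]
  have "g k m (j + 1) - g k m j =
     - (2 / 5 / S * (cosh (2 * x - \<theta>) * sinh (2 * N - 2 * x - \<theta>)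
       - (-1) ^ k * (cosh (2 * x - \<theta>) * sinh (2 * N - 2 * u - \<theta>))
       + (-1) ^ k * (cosh (2 * N - 2 * u - \<theta>) * sinh (2 * x - \<theta>))
       - cosh (2 * N - 2 * u - \<theta>) * sinh (2 * u - \<theta>)))"
    unfolding g_Suc_dipole[OF n k] of_nat_add[of _ 1] of_nat_1 sums
    by (simp add: algebra_simps diff_divide_distrib add_divide_distrib)
  also have "cosh (2 * x - \<theta>) * sinh (2 * N - 2 * x - \<theta>)
       - (-1) ^ k * (cosh (2 * x - \<theta>) * sinh (2 * N - 2 * u - \<theta>))
       + (-1) ^ k * (cosh (2 * N - 2 * u - \<theta>) * sinh (2 * x - \<theta>))
       - cosh (2 * N - 2 * u - \<theta>) * sinh (2 * u - \<theta>) = - (sinh T * (cosh K - (-1) ^ k))"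
  proof -
    \<comment> \<open>Both products have the argument sum \<open>2 * N - 2 * \<theta>\<close>, whose
      sinh cancels; the argument differences leave \<open>sinh T * cosh K\<close>.\<close>
    have arg: "2 * x - \<theta> + (2 * N - 2 * x - \<theta>) = 2 * N - 2 * \<theta>"
      "2 * x - \<theta> - (2 * N - 2 * x - \<theta>) = T - K"
      "2 * N - 2 * u - \<theta> + (2 * u - \<theta>) = 2 * N - 2 * \<theta>"
      "2 * N - 2 * u - \<theta> - (2 * u - \<theta>) = - (T + K)"
      by (simp_all add: T_def K_def)
    have "sinh (2 * N - 2 * u - \<theta>) * cosh (2 * x - \<theta>) - cosh (2 * N - 2 * u - \<theta>) * sinh (2 * x - \<theta>)
        = sinh (- T)"
      unfolding sinh_diff[symmetric] by (simp add: T_def)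
    then have "cosh (2 * x - \<theta>) * sinh (2 * N - 2 * u - \<theta>)
        = cosh (2 * N - 2 * u - \<theta>) * sinh (2 * x - \<theta>) - sinh T"
      by (subst mult.commute[of "cosh _"]) (simp add: diff_eq_eq)
    moreover have "cosh (2 * x - \<theta>) * sinh (2 * N - 2 * x - \<theta>)
        = cosh (2 * N - 2 * u - \<theta>) * sinh (2 * u - \<theta>) - sinh T * cosh K"
      unfolding cosh_mult_sinh arg sinh_minus by (simp add: sinh_add sinh_diff[of T] field_simps)
    moreover have "a - e * p + e * q - b = - (s * (c - e))" if "p = q - s" "a = b - s * c"
      for a b c e p q s :: real
      unfolding that by (simp add: algebra_simps)
    ultimately show ?thesis by blast
  qed
  also have "- (2 / 5 / S * - (sinh T * (cosh K - (-1) ^ k))) = 2 / 5 * (cosh K - (-1) ^ k) / S * sinh T"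
    by simp
  also have "K = 2 * real k * \<theta>"
    by (simp add: K_def x_def u_def algebra_simps)
  also have "T = 2 * (2 * real j + real k - real n) * \<theta>"
    by (simp add: T_def x_def u_def N_def algebra_simps)
  finally show ?thesis by (simp only: S_def)
qed

text \<open>The increments of \<open>g\<close> and of the cosh term are proportional, so
  \<open>g k m j - \<beta> * h j\<close> does not depend on \<open>j\<close>.\<close>

lemma g_closed_form:
  assumes n: "n = m + 2" "n \<ge> 3" and k: "1 \<le> k" "k < n"
  obtains \<alpha> \<beta> where "\<beta> > 0"
    "\<And>j. j \<in> {1..n - k} \<Longrightarrow> g k m j = \<alpha> + \<beta> * cosh (2 * (2 * real j - real (n - k + 1)) * \<theta>)"
proof -
  define S where "S = sinh ((2 * real n - 2) * \<theta>)"
  define K where "K = cosh (2 * real k * \<theta>) - (-1) ^ k"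
  define h where "h j = cosh (2 * (2 * real j - real (n - k + 1)) * \<theta>)" for j
  \<comment> \<open>The ratio of the two increments: \<open>2 / 5 * K / S\<close> against
    \<open>2 * sinh (2 * \<theta>)\<close>.\<close>
  define \<beta> where "\<beta> = 1 / 5 * K / S / sinh (2 * \<theta>)"
  have "(-1) ^ k \<le> (1 :: real)" by (simp add: minus_one_power_iff)
  moreover have "cosh (2 * real k * \<theta>) > 1"
    using k \<theta>_pos cosh_real_strict_mono[of 0 "2 * real k * \<theta>"] by simp
  ultimately have "K > 0" by (simp add: K_def)
  moreover have "S > 0" "sinh (2 * \<theta>) > 0"
    using n \<theta>_pos by (simp_all add: S_def)
  ultimately have "\<beta> > 0" by (simp add: \<beta>_def)
  have h: "h (Suc j) - h j = 2 * sinh (2 * \<theta>) * sinh (2 * (2 * real j + real k - real n) * \<theta>)" for j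
  proof -
    define T where "T = 2 * (2 * real j + real k - real n) * \<theta>"
    have "h (Suc j) = cosh (T + 2 * \<theta>)" "h j = cosh (T - 2 * \<theta>)"
      using k by (auto simp: h_def T_def of_nat_diff algebra_simps intro!: arg_cong[of _ _ cosh])
    then show ?thesis by (simp add: cosh_diff_cosh T_def)
  qed
  have invariant: "g k m j - \<beta> * h j = g k m 1 - \<beta> * h 1" if "1 \<le> j" "j \<le> n - k" for j
    using that
  proof (induction j rule: dec_induct)
    case (step j)
    have "g k m (Suc j) - g k m j = \<beta> * (h (Suc j) - h j)"
      using g_Suc[OF n k(1) step(1)] step(2) that \<open>sinh (2 * \<theta>) > 0\<close>
      by (simp add: h \<beta>_def S_def K_def)
    then show ?case using step by (simp add: algebra_simps)
  qed simp
  have "g k m j = (g k m 1 - \<beta> * h 1) + \<beta> * cosh (2 * (2 * real j - real (n - k + 1)) * \<theta>)"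
    if "j \<in> {1..n - k}" for j
    unfolding h_def[symmetric] using invariant[of j] that by simp
  from \<open>\<beta> > 0\<close> this show thesis by (rule that)
qed

lemma affine_cosh_less_iff:
  fixes x y :: real
  assumes "\<beta> > 0" "c > 0"
  shows "\<alpha> + \<beta> * cosh (2 * x * c) < \<alpha> + \<beta> * cosh (2 * y * c) \<longleftrightarrow> \<bar>x\<bar> < \<bar>y\<bar>"
proof -
  have abs: "cosh (2 * z * c) = cosh (2 * \<bar>z\<bar> * c)" for z :: real
    by (cases "z \<ge> 0") simp_all
  have "cosh (2 * \<bar>x\<bar> * c) < cosh (2 * \<bar>y\<bar> * c) \<longleftrightarrow> \<bar>x\<bar> < \<bar>y\<bar>"
    using assms cosh_real_nonneg_less_iff[of "2 * \<bar>x\<bar> * c" "2 * \<bar>y\<bar> * c"] by simp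
  then show ?thesis unfolding abs[of x] abs[of y] using assms(1) by simp
qed

text \<open>All further claims follow from this order alone. Distances to the midpoint are doubled
  to stay integral.\<close>

lemma g_less_iff:
  assumes n: "n = m + 2" "n \<ge> 3" and k: "1 \<le> k" "k < n"
    and ij: "i \<in> {1..n - k}" "j \<in> {1..n - k}"
  shows "g k m i < g k m j \<longleftrightarrow> \<bar>2 * int i - int (n - k + 1)\<bar> < \<bar>2 * int j - int (n - k + 1)\<bar>"
proof -
  obtain \<alpha> \<beta> where *: "\<beta> > 0"
    "\<And>j. j \<in> {1..n - k} \<Longrightarrow> g k m j = \<alpha> + \<beta> * cosh (2 * (2 * real j - real (n - k + 1)) * \<theta>)"
    using g_closed_form[OF n k] by blast
  have "g k m i < g k m j \<longleftrightarrow> \<bar>2 * real i - real (n - k + 1)\<bar> < \<bar>2 * real j - real (n - k + 1)\<bar>"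
    unfolding *(2)[OF ij(1)] *(2)[OF ij(2)] by (rule affine_cosh_less_iff[OF *(1) \<theta>_pos])
  also have "\<dots> \<longleftrightarrow> \<bar>2 * int i - int (n - k + 1)\<bar> < \<bar>2 * int j - int (n - k + 1)\<bar>"
    unfolding of_int_less_iff[where 'a = real, symmetric] by simp
  finally show ?thesis .
qed

section \<open>Functions ordered by the distance from the midpoint\<close>

context
  fixes f :: "nat \<Rightarrow> real" and p :: nat
  assumes p: "p \<ge> 1"
    and less: "\<And>i j. i \<in> {1..p} \<Longrightarrow> j \<in> {1..p} \<Longrightarrow>
      f i < f j \<longleftrightarrow> \<bar>2 * int i - int (p + 1)\<bar> < \<bar>2 * int j - int (p + 1)\<bar>"
begin

lemma valley_le_iff:
  assumes "i \<in> {1..p}" "j \<in> {1..p}"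
  shows "f i \<le> f j \<longleftrightarrow> \<bar>2 * int i - int (p + 1)\<bar> \<le> \<bar>2 * int j - int (p + 1)\<bar>"
  using less[OF assms(2,1)] by (simp only: not_less[symmetric])

text \<open>The two listed points coincide for odd \<open>p\<close>, which lets one set cover both
  parities.\<close>

lemma valley_minimizers: "minimizers f {1..p} = {(p + 1) div 2, p div 2 + 1}"
proof -
  have eq: "i \<in> minimizers f {1..p} \<longleftrightarrow> i \<in> {1..p} \<and>
      (\<forall>j\<in>{1..p}. \<bar>2 * int i - int (p + 1)\<bar> \<le> \<bar>2 * int j - int (p + 1)\<bar>)" for i
    by (auto simp: minimizers_def is_arg_min_def not_less valley_le_iff)
  show ?thesis
  proof (cases "even p")
    case True
    then obtain q where q: "p = 2 * q" by blast
    then have mem: "q \<in> {1..p}" using p by simp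
    have "i \<in> minimizers f {1..p} \<longleftrightarrow> i = q \<or> i = q + 1" for i
    proof
      assume "i \<in> minimizers f {1..p}"
      then have "\<bar>2 * int i - int (p + 1)\<bar> \<le> \<bar>2 * int q - int (p + 1)\<bar>"
        using mem unfolding eq by blast
      then show "i = q \<or> i = q + 1" unfolding q by linarith
    next
      assume i: "i = q \<or> i = q + 1"
      have "\<bar>2 * int i - int (p + 1)\<bar> \<le> \<bar>2 * int j - int (p + 1)\<bar>" for j
      proof -
        \<comment> \<open>As \<open>p + 1\<close> is odd, a doubled distance is at least 1, and both
          middle points attain 1.\<close>
        have "2 * int j \<noteq> int (p + 1)" unfolding q by presburger
        moreover have "\<bar>2 * int i - int (p + 1)\<bar> = 1" using i q by auto
        ultimately show ?thesis by linarith
      qed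
      then show "i \<in> minimizers f {1..p}" unfolding eq using i p q by auto
    qed
    then show ?thesis using q by auto
  next
    case False
    then obtain q where q: "p = 2 * q + 1" by (blast elim: oddE)
    then have mem: "q + 1 \<in> {1..p}" by simp
    have "i \<in> minimizers f {1..p} \<longleftrightarrow> i = q + 1" for i
    proof
      assume "i \<in> minimizers f {1..p}"
      then have "\<bar>2 * int i - int (p + 1)\<bar> \<le> \<bar>2 * int (q + 1) - int (p + 1)\<bar>"
        using mem unfolding eq by blast
      then show "i = q + 1" unfolding q by simp
    next
      assume "i = q + 1"
      then show "i \<in> minimizers f {1..p}" unfolding eq by (simp add: q)
    qed
    then show ?thesis using q by auto
  qed
qed

text \<open>On the interval the doubled distance is at most \<open>p - 1\<close>, with equality only
  at the ends.\<close>

lemma valley_maximizers: "maximizers f {1..p} = {1, p}"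
proof -
  have eq: "i \<in> maximizers f {1..p} \<longleftrightarrow> i \<in> {1..p} \<and>
      (\<forall>j\<in>{1..p}. \<bar>2 * int j - int (p + 1)\<bar> \<le> \<bar>2 * int i - int (p + 1)\<bar>)" for i
    by (auto simp: maximizers_def is_arg_max_def not_less valley_le_iff)
  have "i \<in> maximizers f {1..p} \<longleftrightarrow> i = 1 \<or> i = p" for i
  proof
    assume "i \<in> maximizers f {1..p}"
    moreover have "1 \<in> {1..p}" using p by simp
    ultimately have "i \<in> {1..p}" "\<bar>2 * int 1 - int (p + 1)\<bar> \<le> \<bar>2 * int i - int (p + 1)\<bar>"
      unfolding eq by blast+
    then show "i = 1 \<or> i = p" by auto
  next
    assume i: "i = 1 \<or> i = p"
    have "\<bar>2 * int j - int (p + 1)\<bar> \<le> \<bar>2 * int i - int (p + 1)\<bar>" if "j \<in> {1..p}" for j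
      using i that by auto
    then show "i \<in> maximizers f {1..p}" unfolding eq using i p by auto
  qed
  then show ?thesis by auto
qed

lemma valley_strict_antimono: "strict_antimono_on {1..(p + 1) div 2} f"
proof (intro monotone_onI)
  fix i j assume "i \<in> {1..(p + 1) div 2}" "j \<in> {1..(p + 1) div 2}" "i < j"
  moreover from this have "2 * j \<le> p + 1" by simp
  ultimately show "f j < f i" by (subst less) auto
qed

lemma valley_strict_mono: "strict_mono_on {p div 2 + 1..p} f"
proof (intro monotone_onI)
  fix i j assume "i \<in> {p div 2 + 1..p}" "j \<in> {p div 2 + 1..p}" "i < j"
  moreover from this have "p + 1 \<le> 2 * i" by simp
  ultimately show "f i < f j" by (subst less) auto
qed

lemma valley_unimodal: "valley_unimodal_on 1 p f"
proof -
  have "antimono_on {1..(p + 1) div 2} f"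
    using valley_strict_antimono by (auto simp: monotone_on_def order_le_less)
  \<comment> \<open>For even \<open>p\<close> this interval starts at the first of two equal minima,
    so \<open>f\<close> is only weakly increasing and \<open>valley_strict_mono\<close> does not
    cover it.\<close>
  moreover have "mono_on {(p + 1) div 2..p} f"
  proof (intro monotone_onI)
    fix i j assume ij: "i \<in> {(p + 1) div 2..p}" "j \<in> {(p + 1) div 2..p}" "i \<le> j"
    then have "p \<le> 2 * i" by simp
    then have "\<bar>2 * int i - int (p + 1)\<bar> \<le> \<bar>2 * int j - int (p + 1)\<bar>"
      using ij(3) by (cases "i = j") auto
    then show "f i \<le> f j" by (subst valley_le_iff) (use ij p in auto)
  qed
  ultimately show ?thesis
    unfolding valley_unimodal_on_def using p by (intro bexI[of _ "(p + 1) div 2"]) auto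
qed

end

theorem theorem6p3:
  fixes n m k :: nat
  assumes "n \<ge> 3" and "m = n - 2" and "1 \<le> k" and "k \<le> n - 1"
  shows "valley_unimodal_on 1 (n - k) (g k m)
    \<and> maximizers (g k m) {1..n - k} = {1, n - k}
    \<and> (odd (int m - int k) \<longrightarrow>
         real ` minimizers (g k m) {1..n - k} = {(real m - real k + 3) / 2})
    \<and> (even (int m - int k) \<longrightarrow>
         real ` minimizers (g k m) {1..n - k} =
           {(real m - real k + 3 + 1) / 2, (real m - real k + 3 - 1) / 2})
    \<and> strict_antimono_on {1..Min (minimizers (g k m) {1..n - k})} (g k m)
    \<and> strict_mono_on {Max (minimizers (g k m) {1..n - k})..n - k} (g k m)
    \<and> (\<forall>j\<in>{1..n - k}. g k m j = g k m (n - k - j + 1))"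
proof -
  have n: "n = m + 2" "k < n" using assms by auto
  define p where "p = n - k"
  have p: "p \<ge> 1" using n by (simp add: p_def)
  have less: "g k m i < g k m j \<longleftrightarrow> \<bar>2 * int i - int (p + 1)\<bar> < \<bar>2 * int j - int (p + 1)\<bar>"
    if "i \<in> {1..p}" "j \<in> {1..p}" for i j
    using g_less_iff[OF n(1) assms(1,3) n(2)] that by (simp add: p_def)
  \<comment> \<open>Here \<open>p = m - k + 2\<close>: the parity is that of \<open>m - k\<close>,
    and the stated midpoint is half of \<open>p + 1\<close>.\<close>
  have c: "real m - real k + 3 = real p + 1" and par: "even (int m - int k) \<longleftrightarrow> even p"
    using n by (auto simp: p_def of_nat_diff)
  have min: "minimizers (g k m) {1..p} = {(p + 1) div 2, p div 2 + 1}"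
    by (rule valley_minimizers[OF p less])
  have "real ` {(p + 1) div 2, p div 2 + 1} = {(real p + 1) / 2}" if "odd p"
    using that by (auto elim!: oddE)
  moreover have "real ` {(p + 1) div 2, p div 2 + 1} = {(real p + 1 + 1) / 2, (real p + 1 - 1) / 2}" if "even p"
    using that by (auto elim!: evenE)
  moreover have "Min {(p + 1) div 2, p div 2 + 1} = (p + 1) div 2" "Max {(p + 1) div 2, p div 2 + 1} = p div 2 + 1"
    by (simp_all add: min_def max_def)
  moreover have "g k m j = g k m (p - j + 1)" if "j \<in> {1..p}" for j
  proof -
    have mem: "p - j + 1 \<in> {1..p}" using that by auto
    \<comment> \<open>Reflection preserves the distance, so neither value is smaller than the
      other.\<close>
    have "\<bar>2 * int (p - j + 1) - int (p + 1)\<bar> = \<bar>2 * int j - int (p + 1)\<bar>"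
      using that by (auto simp: of_nat_diff)
    then show ?thesis using less[OF that mem] less[OF mem that] by linarith
  qed
  ultimately show ?thesis
    unfolding p_def[symmetric] unfolding min unfolding c par
    using valley_unimodal[OF p less] valley_maximizers[OF p less]
      valley_strict_antimono[OF p less] valley_strict_mono[OF p less]
    by simp
qed

end
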